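(* Let $\sigma^2>1$, $0=s_0<s_1<\dots<s_N=T$, $l_n=s_n-s_{n-1}$, $E_0,\dots,E_{N-1}\ge 0$, and $g(r_1,r_2)=2^{2(r_1+r_2)}+(\sigma^2-1)2^{2r_2}-\sigma^2$. For $\mu_1,\mu_2\ge0$, not both zero, consider $$\max_{r_{1n},r_{2n}\ge 0}\ \mu_1\sum_{n=1}^N r_{1n}l_n+\mu_2\sum_{n=1}^N r_{2n}l_n\quad\text{s.t.}\quad \sum_{n=1}^j g(r_{1n},r_{2n})l_n\le\sum_{n=0}^{j-1}E_n,\quad 1\le j\le N .$$ Then the total transmit power sequence $\big(g(r_{1n},r_{2n})\big)_{n=1}^N$ of an optimal solution is independent of the values of $\mu_1,\mu_2$, and it is the same as the optimal transmit power sequence of the single-user problem $$\max_{p_1,\dots,p_N\ge 0}\ \sum_{n=1}^N \tfrac12\log_2(1+p_n)\,l_n\quad\text{s.t.}\quad\sum_{n=1}^j p_nl_n\le\sum_{n=0}^{j-1}E_n,\quad 1\le j\le N.$$ Specifically, with $i_0=0$ and recursively (until $i_n=N$) $$i_n=\arg\min_{i_{n-1}<i\le N}\left\{\frac{\sum_{j=i_{n-1}}^{i-1}E_j}{s_i-s_{i_{n-1}}}\right\},\qquad P_n=\frac{\sum_{j=i_{n-1}}^{i_n-1}E_j}{s_{i_n}-s_{i_{n-1}}},$$ the optimal total transmit power equals $P_n$ throughout $[s_{i_{n-1}},s_{i_n})$, i.e., at $t=s_{i_n}$ the power switches from $P_n$ to $P_{n+1}$.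
   Context: Setting: a transmitter harvests energy $E_k$ at time $s_k$ ($k=0,\dots,N-1$) and must stop at the deadline $T=s_N$. It serves two users over an AWGN broadcast channel with noise variances $1$ (user 1) and $\sigma^2>1$ (user 2). $r_{1n},r_{2n}$ are the rates to users 1 and 2 on $[s_{n-1},s_n)$, and $g(r_1,r_2)$ is the total transmit power needed for the rate pair $(r_1,r_2)$. In the $\arg\min$, any minimizer may be taken in case of ties; the resulting power profile over $[0,T)$ does not depend on the choice. *)

theory Defs
  imports Complex_Main "HOL-Library.Indicator_Function"
begin

text \<open>
  Sequences indexed by \<open>1, \<dots>, N\<close> (rates, powers) or by \<open>0, \<dots>, N\<close> (epochs \<open>s\<close>) or by
  \<open>0, \<dots>, N - 1\<close> (harvested energies \<open>E\<close>) are functions on the naturals; only the values at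
  these indices matter.
\<close>

definition slot_length :: "(nat \<Rightarrow> real) \<Rightarrow> nat \<Rightarrow> real" where
  "slot_length s n = s n - s (n - 1)"

definition energy_causal :: "nat \<Rightarrow> (nat \<Rightarrow> real) \<Rightarrow> (nat \<Rightarrow> real) \<Rightarrow> (nat \<Rightarrow> real) \<Rightarrow> bool" where
  "energy_causal N s E p \<longleftrightarrow>
     (\<forall>j\<in>{1..N}. (\<Sum>n=1..j. p n * slot_length s n) \<le> (\<Sum>n=0..<j. E n))"


text \<open>Total power needed for a rate pair on the AWGN broadcast channel with noise variances
  \<open>1\<close> and \<open>\<sigma>\<^sup>2\<close>.\<close>

definition bc_power :: "real \<Rightarrow> real \<Rightarrow> real \<Rightarrow> real" where
  "bc_power \<sigma> r1 r2 = 2 powr (2 * (r1 + r2)) + (\<sigma>\<^sup>2 - 1) * 2 powr (2 * r2) - \<sigma>\<^sup>2"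

definition bc_feasible ::
  "real \<Rightarrow> nat \<Rightarrow> (nat \<Rightarrow> real) \<Rightarrow> (nat \<Rightarrow> real) \<Rightarrow> (nat \<Rightarrow> real) \<times> (nat \<Rightarrow> real) \<Rightarrow> bool" where
  "bc_feasible \<sigma> N s E = (\<lambda>(r1, r2).
     (\<forall>n\<in>{1..N}. 0 \<le> r1 n \<and> 0 \<le> r2 n) \<and>
     energy_causal N s E (\<lambda>n. bc_power \<sigma> (r1 n) (r2 n)))"

definition bc_objective ::
  "real \<Rightarrow> real \<Rightarrow> nat \<Rightarrow> (nat \<Rightarrow> real) \<Rightarrow> (nat \<Rightarrow> real) \<times> (nat \<Rightarrow> real) \<Rightarrow> real" where
  "bc_objective \<mu>1 \<mu>2 N s = (\<lambda>(r1, r2).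
     \<mu>1 * (\<Sum>n=1..N. r1 n * slot_length s n) + \<mu>2 * (\<Sum>n=1..N. r2 n * slot_length s n))"

definition bc_optimal ::
  "real \<Rightarrow> real \<Rightarrow> real \<Rightarrow> nat \<Rightarrow> (nat \<Rightarrow> real) \<Rightarrow> (nat \<Rightarrow> real) \<Rightarrow> (nat \<Rightarrow> real) \<Rightarrow> (nat \<Rightarrow> real) \<Rightarrow> bool"
where
  "bc_optimal \<sigma> \<mu>1 \<mu>2 N s E r1 r2 \<longleftrightarrow>
     is_arg_max (bc_objective \<mu>1 \<mu>2 N s) (bc_feasible \<sigma> N s E) (r1, r2)"


definition su_feasible :: "nat \<Rightarrow> (nat \<Rightarrow> real) \<Rightarrow> (nat \<Rightarrow> real) \<Rightarrow> (nat \<Rightarrow> real) \<Rightarrow> bool" where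
  "su_feasible N s E p \<longleftrightarrow> (\<forall>n\<in>{1..N}. 0 \<le> p n) \<and> energy_causal N s E p"

definition su_objective :: "nat \<Rightarrow> (nat \<Rightarrow> real) \<Rightarrow> (nat \<Rightarrow> real) \<Rightarrow> real" where
  "su_objective N s p = (\<Sum>n=1..N. 1 / 2 * log 2 (1 + p n) * slot_length s n)"

definition su_optimal :: "nat \<Rightarrow> (nat \<Rightarrow> real) \<Rightarrow> (nat \<Rightarrow> real) \<Rightarrow> (nat \<Rightarrow> real) \<Rightarrow> bool" where
  "su_optimal N s E p \<longleftrightarrow> is_arg_max (su_objective N s) (su_feasible N s E) p"


text \<open>The constant power that spends, on \<open>[s\<^sub>a, s\<^sub>b)\<close>, exactly the energy harvested in it.\<close>

definition mean_power :: "(nat \<Rightarrow> real) \<Rightarrow> (nat \<Rightarrow> real) \<Rightarrow> nat \<Rightarrow> nat \<Rightarrow> real" where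
  "mean_power s E a b = (\<Sum>j=a..<b. E j) / (s b - s a)"

text \<open>
  \<open>i\<^sub>0, \<dots>, i\<^sub>K\<close> is a possible outcome of the recursion, with \<open>K\<close> the step at which it stops.
  It is a relation since the minimizer need not be unique; the sequence is strictly increasing up
  to \<open>K\<close>, so \<open>N\<close> is not reached earlier.
\<close>

definition switching_indices ::
  "nat \<Rightarrow> (nat \<Rightarrow> real) \<Rightarrow> (nat \<Rightarrow> real) \<Rightarrow> nat \<Rightarrow> (nat \<Rightarrow> nat) \<Rightarrow> bool" where
  "switching_indices N s E K i \<longleftrightarrow>
     i 0 = 0 \<and> i K = N \<and>
     (\<forall>n\<in>{1..K}. is_arg_min (mean_power s E (i (n - 1))) (\<lambda>m. i (n - 1) < m \<and> m \<le> N) (i n))"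

text \<open>The function of time that equals \<open>p\<^sub>n\<close> on \<open>[s\<^sub>n\<^sub>-\<^sub>1, s\<^sub>n)\<close>.\<close>

definition power_profile :: "nat \<Rightarrow> (nat \<Rightarrow> real) \<Rightarrow> (nat \<Rightarrow> real) \<Rightarrow> real \<Rightarrow> real" where
  "power_profile N s p t = (\<Sum>n=1..N. p n * indicator {s (n - 1)..<s n} t)"

end

theory Submission
  imports Defs "HOL-Analysis.Analysis"
begin

text \<open>
  The largest weighted rate that a total power \<open>p\<close> buys is
  \<open>h p = 1 / (2 * ln 2) * integral {0..p} (\<lambda>z. max (\<mu>1 / (1 + z)) (\<mu>2 / (\<sigma>\<^sup>2 + z)))\<close>: each infinitesimal layer of
  power goes to the user that makes the better use of it. The integrand is strictly decreasing, so
  \<open>h\<close> lies strictly below its tangents. For every such \<open>h\<close> the same power sequence maximizes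
  \<open>\<Sum>n. h (p n) * l n\<close>, and it is the only maximizer: the nondecreasing one that jumps only at times
  where the battery is empty and that ends with an empty battery. The greedy recursion produces it.
  Single-user capacity is one more instance of \<open>h\<close>.
\<close>

section \<open>Functions lying strictly below their tangents on the nonnegative reals\<close>

text \<open>\<open>w q\<close> is a supergradient of \<open>h\<close> at \<open>q\<close>, read as
  the price of energy at power level \<open>q\<close>. Its sign ensures that energy left over at the
  deadline is never profitable.\<close>

definition strict_tangent :: "(real \<Rightarrow> real) \<Rightarrow> (real \<Rightarrow> real) \<Rightarrow> bool" where
  "strict_tangent h w \<longleftrightarrow>
     (\<forall>q\<ge>0. 0 \<le> w q \<and> (\<forall>p\<ge>0. p \<noteq> q \<longrightarrow> h p < h q + w q * (p - q)))"

text \<open>By the mean value theorem the chord from \<open>q\<close> to \<open>p\<close> has slope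
  \<open>w z\<close> with \<open>z\<close> strictly between them, and \<open>w\<close> decreases
  strictly. Derivatives are taken within \<open>{0..b}\<close> because the value functions matter
  only on the nonnegative side of \<open>0\<close>.\<close>

lemma strict_tangentI:
  assumes der: "\<And>b x. 0 \<le> x \<Longrightarrow> x \<le> b \<Longrightarrow> (h has_real_derivative w x) (at x within {0..b})"
    and dec: "\<And>x y. 0 \<le> x \<Longrightarrow> x < y \<Longrightarrow> w y < w x"
    and nonneg: "\<And>x. 0 \<le> x \<Longrightarrow> 0 \<le> w x"
  shows "strict_tangent h w"
proof -
  have mvt: "\<exists>z\<in>{x<..<y}. h y - h x = w z * (y - x)" if "0 \<le> x" "x < y" for x y
  proof (rule mvt_simple[OF \<open>x < y\<close>, of h "\<lambda>z. (*) (w z)"])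
    fix z assume "x \<le> z" "z \<le> y"
    then have "(h has_real_derivative w z) (at z within {x..y})"
      using that by (intro DERIV_subset[OF der[of z y]]) auto
    then show "(h has_derivative (*) (w z)) (at z within {x..y})"
      by (simp add: has_field_derivative_def)
  qed
  have "h p < h q + w q * (p - q)" if "0 \<le> p" "0 \<le> q" "p \<noteq> q" for p q
  proof (cases "q < p")
    case True
    then obtain z where z: "q < z" "z < p" "h p - h q = w z * (p - q)"
      using mvt[OF \<open>0 \<le> q\<close> True] by auto
    have "w z * (p - q) < w q * (p - q)"
      using dec[of q z] z that by (intro mult_strict_right_mono) auto
    then show ?thesis using z by linarith
  next
    case False
    then have "p < q" using that by simp
    then obtain z where z: "p < z" "z < q" "h q - h p = w z * (q - p)"
      using mvt[OF \<open>0 \<le> p\<close> \<open>p < q\<close>] by auto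
    have "w q * (q - p) < w z * (q - p)"
      using dec[of z q] z that by (intro mult_strict_right_mono) auto
    then show ?thesis using z by (simp add: algebra_simps)
  qed
  then show ?thesis using nonneg by (auto simp: strict_tangent_def)
qed

lemma strict_tangent_le:
  assumes "strict_tangent h w" "0 \<le> p" "0 \<le> q"
  shows "h p \<le> h q + w q * (p - q)"
  using assms by (cases "p = q") (auto simp: strict_tangent_def less_imp_le)

text \<open>Add the tangent inequality at \<open>q\<close>, evaluated at \<open>p\<close>, to the
  one at \<open>p\<close>, evaluated at \<open>q\<close>.\<close>

lemma strict_tangent_antimono:
  assumes "strict_tangent h w" "0 \<le> p" "p \<le> q"
  shows "w q \<le> w p"
proof (cases "p = q")
  case False
  then have "h p < h q + w q * (p - q)" "h q < h p + w p * (q - p)"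
    using assms by (auto simp: strict_tangent_def)
  then have "w q * (q - p) \<le> w p * (q - p)" by (simp add: algebra_simps)
  then show ?thesis using False assms by simp
qed simp

subsection \<open>The staircase power allocation\<close>

locale energy_harvesting =
  fixes N :: nat and s E :: "nat \<Rightarrow> real"
  assumes s_Suc: "n < N \<Longrightarrow> s n < s (Suc n)"
    and E_nonneg: "n < N \<Longrightarrow> 0 \<le> E n"
begin

definition consumed :: "(nat \<Rightarrow> real) \<Rightarrow> nat \<Rightarrow> real" where
  "consumed p j = (\<Sum>n=1..j. p n * slot_length s n)"

definition harvested :: "nat \<Rightarrow> real" where
  "harvested j = (\<Sum>n=0..<j. E n)"

lemma energy_causal_iff: "energy_causal N s E p \<longleftrightarrow> (\<forall>j\<in>{1..N}. consumed p j \<le> harvested j)"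
  by (simp add: energy_causal_def consumed_def harvested_def)

lemma consumed_0 [simp]: "consumed p 0 = 0"
  by (simp add: consumed_def)

lemma consumed_Suc: "consumed p (Suc j) = consumed p j + p (Suc j) * (s (Suc j) - s j)"
  by (simp add: consumed_def slot_length_def)

lemma s_less: "a < b \<Longrightarrow> b \<le> N \<Longrightarrow> s a < s b"
proof (induction b)
  case (Suc b)
  then show ?case using s_Suc[of b] by (cases "a = b") auto
qed simp

lemma s_le: "a \<le> b \<Longrightarrow> b \<le> N \<Longrightarrow> s a \<le> s b"
  using s_less[of a b] by (cases "a = b") auto

lemma slot_length_pos: "n \<in> {1..N} \<Longrightarrow> 0 < slot_length s n"
  using s_less[of "n - 1" n] by (auto simp: slot_length_def)

lemma mean_power_nonneg: "a < b \<Longrightarrow> b \<le> N \<Longrightarrow> 0 \<le> mean_power s E a b"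
  using s_less[of a b] E_nonneg unfolding mean_power_def
  by (intro divide_nonneg_pos sum_nonneg) auto

lemma mean_power_mult:
  assumes "a < b" "b \<le> N"
  shows "mean_power s E a b * (s b - s a) = harvested b - harvested a"
proof -
  have "harvested b = harvested a + (\<Sum>j=a..<b. E j)"
    using assms by (simp add: harvested_def sum.atLeastLessThan_concat)
  then show ?thesis using s_less[OF assms] by (simp add: mean_power_def)
qed

text \<open>Feasibility with complementary slackness: the power may rise only where the causality
  constraint is tight, and the last constraint is tight. No objective occurs, so one staircase
  serves all of them.\<close>

definition staircase :: "(nat \<Rightarrow> real) \<Rightarrow> bool" where
  "staircase p \<longleftrightarrow> su_feasible N s E p \<and> consumed p N = harvested N \<and>
     (\<forall>j\<in>{1..<N}. p j \<le> p (Suc j) \<and> (p j = p (Suc j) \<or> consumed p j = harvested j))"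

text \<open>Abel summation: the prices \<open>w (p n)\<close> decrease, and strictly so only where all energy
  harvested so far is spent.\<close>
lemma staircase_price:
  assumes p: "staircase p" and q: "su_feasible N s E q" and h: "strict_tangent h w"
  shows "(\<Sum>n=1..N. w (p n) * (q n - p n) * slot_length s n) \<le> 0"
proof (cases "N = 0")
  case False
  have "(\<Sum>n=1..j. w (p n) * (q n - p n) * slot_length s n)
      \<le> w (p j) * (consumed q j - consumed p j)" if "1 \<le> j" "j \<le> N" for j
    using that
  proof (induction j rule: dec_induct)
    case base
    then show ?case by (simp add: consumed_def algebra_simps)
  next
    case (step j)
    have j: "p j \<le> p (Suc j)" "p j = p (Suc j) \<or> consumed p j = harvested j" "0 \<le> p j"
      "consumed q j \<le> harvested j"
      using step p q by (auto simp: staircase_def su_feasible_def energy_causal_iff)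
    have "w (p (Suc j)) \<le> w (p j)"
      using strict_tangent_antimono[OF h] j by blast
    \<comment> \<open>If \<open>p j = p (Suc j)\<close>, both sides agree. Otherwise
      \<open>p\<close> has emptied the battery at \<open>j\<close>, so \<open>q\<close> has consumed
      no more than \<open>p\<close>, and a lower price on a nonpositive gap increases the
      product.\<close>
    then have "w (p j) * (consumed q j - consumed p j)
        \<le> w (p (Suc j)) * (consumed q j - consumed p j)"
      using j by (auto intro: mult_right_mono_neg)
    then show ?case using step by (simp add: consumed_Suc slot_length_def algebra_simps)
  qed
  from this[of N] have "(\<Sum>n=1..N. w (p n) * (q n - p n) * slot_length s n)
      \<le> w (p N) * (consumed q N - consumed p N)" using False by simp
  \<comment> \<open>The final price is nonnegative, and \<open>q\<close> cannot consume more than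
    \<open>harvested N\<close>, which \<open>p\<close> consumes entirely.\<close>
  also have "\<dots> \<le> 0"
    using False p q h
    by (intro mult_nonneg_nonpos)
      (auto simp: staircase_def su_feasible_def energy_causal_iff strict_tangent_def)
  finally show ?thesis .
qed simp

text \<open>Replace \<open>h (q n)\<close> by the tangent at \<open>p n\<close>, which loses
  strictly in slot \<open>m\<close>; the linear terms then sum to at most zero by
  \<open>staircase_price\<close>.\<close>

lemma staircase_less:
  assumes p: "staircase p" and q: "su_feasible N s E q" and h: "strict_tangent h w"
    and m: "m \<in> {1..N}" "q m \<noteq> p m"
  shows "(\<Sum>n=1..N. h (q n) * slot_length s n) < (\<Sum>n=1..N. h (p n) * slot_length s n)"
proof -
  have nonneg: "0 \<le> p n" "0 \<le> q n" if "n \<in> {1..N}" for n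
    using p q that by (auto simp: staircase_def su_feasible_def)
  have "(\<Sum>n=1..N. h (q n) * slot_length s n)
      < (\<Sum>n=1..N. (h (p n) + w (p n) * (q n - p n)) * slot_length s n)"
  proof (rule sum_strict_mono_ex1)
    show "\<forall>n\<in>{1..N}. h (q n) * slot_length s n
        \<le> (h (p n) + w (p n) * (q n - p n)) * slot_length s n"
      using strict_tangent_le[OF h] nonneg slot_length_pos by (auto intro!: mult_right_mono less_imp_le)
    show "\<exists>n\<in>{1..N}. h (q n) * slot_length s n
        < (h (p n) + w (p n) * (q n - p n)) * slot_length s n"
      using m h nonneg slot_length_pos
      by (intro bexI[of _ m] mult_strict_right_mono) (auto simp: strict_tangent_def)
  qed simp
  also have "\<dots> = (\<Sum>n=1..N. h (p n) * slot_length s n)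
      + (\<Sum>n=1..N. w (p n) * (q n - p n) * slot_length s n)"
    by (simp add: distrib_right sum.distrib)
  finally show ?thesis using staircase_price[OF p q h] by linarith
qed

lemma staircase_le:
  assumes "staircase p" "su_feasible N s E q" "strict_tangent h w"
  shows "(\<Sum>n=1..N. h (q n) * slot_length s n) \<le> (\<Sum>n=1..N. h (p n) * slot_length s n)"
proof (cases "\<exists>m\<in>{1..N}. q m \<noteq> p m")
  case True
  then show ?thesis using staircase_less[OF assms] by (auto intro: less_imp_le)
next
  case False
  then show ?thesis by (intro sum_mono) auto
qed

subsection \<open>The switching indices\<close>

lemma switching_indices_exist: "\<exists>K i. switching_indices N s E K i"
proof -
  \<comment> \<open>The recursion started at an arbitrary \<open>a\<close>, so that an outcome can
    be built by induction on the remaining distance \<open>N - a\<close>.\<close>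
  define chain where "chain a K i \<longleftrightarrow> i 0 = a \<and> i K = N \<and>
      (\<forall>n\<in>{1..K}. is_arg_min (mean_power s E (i (n - 1))) (\<lambda>m. i (n - 1) < m \<and> m \<le> N) (i n))"
    for a K :: nat and i
  have "\<exists>K i. chain a K i" if "a \<le> N" for a
    using that
  proof (induction "N - a" arbitrary: a rule: less_induct)
    case less
    show ?case
    proof (cases "a = N")
      case True
      then show ?thesis by (intro exI[of _ 0] exI[of _ "\<lambda>_. a"]) (auto simp: chain_def)
    next
      case False
      have "finite {a<..N}" "{a<..N} \<noteq> {}" using False less by auto
      then obtain b where b: "is_arg_min (mean_power s E a) (\<lambda>m. m \<in> {a<..N}) b"
        using ex_is_arg_min_if_finite by blast
      then have ab: "a < b" "b \<le> N" "N - b < N - a"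
        using False less.prems by (auto simp: is_arg_min_def)
      then obtain K i where i: "chain b K i" using less.hyps by blast
      \<comment> \<open>Prepending \<open>a\<close> shifts the indices by one: step 1 is the new
        minimization, and step \<open>Suc (Suc k)\<close> is step \<open>Suc k\<close> of the old
        chain.\<close>
      let ?i = "case_nat a i"
      have "is_arg_min (mean_power s E (?i (n - 1))) (\<lambda>m. ?i (n - 1) < m \<and> m \<le> N) (?i n)"
        if "n \<in> {1..Suc K}" for n
      proof (cases "n = 1")
        case True
        then show ?thesis using b i by (simp add: chain_def)
      next
        case False
        define k where "k = n - 2"
        have k: "n = Suc (Suc k)" "Suc k \<in> {1..K}" using False that by (auto simp: k_def)
        have "is_arg_min (mean_power s E (i (Suc k - 1))) (\<lambda>m. i (Suc k - 1) < m \<and> m \<le> N) (i (Suc k))"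
          using i k(2) unfolding chain_def by blast
        then show ?thesis using k(1) by simp
      qed
      then have "chain a (Suc K) ?i" using i by (simp add: chain_def)
      then show ?thesis by blast
    qed
  qed
  from this[of 0] show ?thesis by (simp add: switching_indices_def chain_def)
qed

text \<open>Constant mean power on each block empties the battery at the block's end. Minimality
  against earlier indices gives causality inside a block, and minimality against the end of the next
  block gives monotonicity. Ties may be broken in any way.\<close>

lemma switching_indices_staircase:
  assumes i: "switching_indices N s E K i"
  obtains p where "staircase p"
    and "\<And>k n. k < K \<Longrightarrow> i k < n \<Longrightarrow> n \<le> i (Suc k) \<Longrightarrow> p n = mean_power s E (i k) (i (Suc k))"
proof -
  have i0: "i 0 = 0" "i K = N" using i by (auto simp: switching_indices_def)
  have arg: "is_arg_min (mean_power s E (i k)) (\<lambda>m. i k < m \<and> m \<le> N) (i (Suc k))" if "k < K" for k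
    using i that by (auto simp: switching_indices_def dest!: bspec[of _ _ "Suc k"])
  then have i_step: "i k < i (Suc k)" "i (Suc k) \<le> N" if "k < K" for k
    using that by (auto simp: is_arg_min_def)
  have mean_le: "mean_power s E (i k) (i (Suc k)) \<le> mean_power s E (i k) m"
    if "k < K" "i k < m" "m \<le> N" for k m
    using arg[of k] that by (auto simp: is_arg_min_def not_less)
  have mono: "i k \<le> i l" if "k \<le> l" "l \<le> K" for k l
    using that
  proof (induction l rule: dec_induct)
    case (step n)
    then show ?case using i_step(1)[of n] by linarith
  qed simp
  \<comment> \<open>Blocks are counted from 0: block \<open>k\<close> consists of the slots
    \<open>n\<close> with \<open>i k < n\<close> and \<open>n \<le> i (Suc k)\<close>.\<close>
  define block where "block n = (LEAST k. n \<le> i (Suc k))" for n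
  have block_eq: "block n = k" if "k < K" "i k < n" "n \<le> i (Suc k)" for k n
    unfolding block_def
  proof (rule Least_equality)
    fix l assume "n \<le> i (Suc l)"
    then show "k \<le> l" using mono[of "Suc l" k] that by (cases "k \<le> l") auto
  qed fact
  have block: "block n < K \<and> i (block n) < n \<and> n \<le> i (Suc (block n))" if "n \<in> {1..N}" for n
  proof -
    have K: "0 < K" using i0 that by (cases K) auto
    then have top: "n \<le> i (Suc (K - 1))" using i0 that by simp
    have le: "block n \<le> K - 1" unfolding block_def by (rule Least_le) (rule top)
    have n: "n \<le> i (Suc (block n))" unfolding block_def by (rule LeastI) (rule top)
    have "i (block n) < n"
    proof (cases "block n")
      case 0
      then show ?thesis using i0 that by simp
    next
      case (Suc k)
      then show ?thesis using not_less_Least[of k "\<lambda>k. n \<le> i (Suc k)"] unfolding block_def by auto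
    qed
    then show ?thesis using le n K by linarith
  qed
  define p where "p n = mean_power s E (i (block n)) (i (Suc (block n)))" for n
  have p_eq: "p n = mean_power s E (i k) (i (Suc k))" if "k < K" "i k < n" "n \<le> i (Suc k)" for k n
    using block_eq[OF that] by (simp add: p_def)
  have consumed_block: "consumed p n = consumed p (i k) + mean_power s E (i k) (i (Suc k)) * (s n - s (i k))"
    if "i k \<le> n" "n \<le> i (Suc k)" "k < K" for k n
    using that(1,2)
  proof (induction n rule: dec_induct)
    case (step n)
    then show ?case using p_eq[of k "Suc n"] \<open>k < K\<close> by (simp add: consumed_Suc algebra_simps)
  qed simp
  have tight: "consumed p (i k) = harvested (i k)" if "k \<le> K" for k
    using that
  proof (induction k)
    case 0
    then show ?case using i0 by (simp add: harvested_def)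
  next
    case (Suc k)
    then show ?case
      using consumed_block[of k "i (Suc k)"] mean_power_mult[of "i k" "i (Suc k)"] i_step[of k] by simp
  qed
  have "staircase p"
    unfolding staircase_def su_feasible_def energy_causal_iff
  proof (intro conjI ballI)
    fix n assume n: "n \<in> {1..N}"
    show "0 \<le> p n" unfolding p_def using block[OF n] i_step by (intro mean_power_nonneg) auto
    let ?k = "block n"
    \<comment> \<open>The index \<open>n\<close> competes in the minimization from
      \<open>i ?k\<close>, so the mean harvest up to \<open>n\<close> is at least the power of the
      block.\<close>
    have "mean_power s E (i ?k) (i (Suc ?k)) * (s n - s (i ?k))
        \<le> mean_power s E (i ?k) n * (s n - s (i ?k))"
      using block[OF n] n s_le[of "i ?k" n] by (intro mult_right_mono mean_le) auto
    also have "\<dots> = harvested n - harvested (i ?k)"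
      using block[OF n] n by (intro mean_power_mult) auto
    finally show "consumed p n \<le> harvested n"
      using consumed_block[of ?k n] tight[of ?k] block[OF n] by simp
  next
    show "consumed p N = harvested N" using tight[of K] i0 by simp
  next
    fix j assume j: "j \<in> {1..<N}"
    let ?k = "block j"
    have k: "?k < K" "i ?k < j" "j \<le> i (Suc ?k)" using block[of j] j by auto
    have "p j \<le> p (Suc j) \<and> (p j = p (Suc j) \<or> consumed p j = harvested j)"
    proof (cases "j = i (Suc ?k)")
      case False
      then have "p (Suc j) = p j" using k p_eq[of ?k "Suc j"] p_eq[of ?k j] by simp
      then show ?thesis by simp
    next
      case True
      \<comment> \<open>Since \<open>j < N\<close>, the block ending at \<open>j\<close> is not the
        last one.\<close>
      have K: "Suc ?k < K" using True j i0 k by (cases "Suc ?k = K") auto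
      define a b c where "a = i ?k" and "b = i (Suc ?k)" and "c = i (Suc (Suc ?k))"
      have abc: "a < b" "b < c" "c \<le> N" using i_step[of ?k] i_step[of "Suc ?k"] K by (auto simp: a_def b_def c_def)
      have "p j = mean_power s E a b" using p_eq[of ?k j] k by (simp add: a_def b_def)
      moreover have "p (Suc j) = mean_power s E b c"
        using p_eq[of "Suc ?k" "Suc j"] K i_step[of "Suc ?k"] True by (simp add: b_def c_def)
      moreover have "mean_power s E a b \<le> mean_power s E b c"
      proof -
        \<comment> \<open>The mean over \<open>a..c\<close> is a weighted average of those over
          \<open>a..b\<close> and \<open>b..c\<close>. As the first part does not exceed the
          average, the second part is at least as large as the first.\<close>
        have "mean_power s E a b * (s c - s a) \<le> mean_power s E a c * (s c - s a)"
          using mean_le[of ?k c] abc k s_le[of a c] by (intro mult_right_mono) (auto simp: a_def b_def)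
        then have "mean_power s E a b * (s c - s b) \<le> mean_power s E b c * (s c - s b)"
          using mean_power_mult[of a b] mean_power_mult[of b c] mean_power_mult[of a c] abc
          by (simp add: algebra_simps)
        then show ?thesis using s_less[of b c] abc by simp
      qed
      moreover have "consumed p j = harvested j" using tight[of "Suc ?k"] K True by simp
      ultimately show ?thesis by simp
    qed
    then show "p j \<le> p (Suc j)" "p j = p (Suc j) \<or> consumed p j = harvested j" by auto
  qed
  then show ?thesis using p_eq that by blast
qed

section \<open>The power as a function of time\<close>

text \<open>The slots are disjoint because \<open>s\<close> increases, so only the indicator of slot
  \<open>m\<close> survives.\<close>

lemma power_profile_eq:
  assumes "m \<in> {1..N}" "t \<in> {s (m - 1)..<s m}"
  shows "power_profile N s p t = p m"
proof -
  have "indicator {s (n - 1)..<s n} t = (if n = m then 1 else 0 :: real)" if "n \<in> {1..N}" for n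
  proof -
    consider "n = m" | "n \<le> m - 1" | "m \<le> n - 1" using that assms(1) by fastforce
    then show ?thesis
    proof cases
      case 2
      then have "s n \<le> s (m - 1)" using assms by (intro s_le) auto
      then show ?thesis using 2 assms that by (auto simp: indicator_def)
    next
      case 3
      then have "s m \<le> s (n - 1)" using that by (intro s_le) auto
      then show ?thesis using 3 assms that by (auto simp: indicator_def)
    qed (use assms in auto)
  qed
  then have "power_profile N s p t = (\<Sum>n=1..N. if n = m then p n else 0)"
    unfolding power_profile_def by (intro sum.cong) auto
  then show ?thesis using assms(1) by simp
qed

lemma slot_exists:
  assumes "a \<le> b" "t \<in> {s a..<s b}"
  obtains m where "a < m" "m \<le> b" "t \<in> {s (m - 1)..<s m}"
proof -
  \<comment> \<open>The first epoch after \<open>t\<close>, searched from \<open>a\<close> on; by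
    minimality the epoch before it is not after \<open>t\<close>.\<close>
  define m where "m = (LEAST m. a \<le> m \<and> t < s m)"
  have m: "a \<le> m \<and> t < s m" "m \<le> b"
    unfolding m_def using assms by (auto intro: LeastI[of _ b] Least_le LeastI2)
  have "a < m" using m assms by (cases "a = m") auto
  moreover have "s (m - 1) \<le> t"
    using not_less_Least[of "m - 1" "\<lambda>m. a \<le> m \<and> t < s m"] \<open>a < m\<close> m_def by auto
  ultimately show ?thesis using that m by auto
qed

subsection \<open>Optimality of the staircase\<close>

lemma su_tangent: "strict_tangent (\<lambda>p. 1 / 2 * log 2 (1 + p)) (\<lambda>p. 1 / (2 * ln 2 * (1 + p)))"
proof (rule strict_tangentI)
  fix b x :: real assume "0 \<le> x"
  then show "((\<lambda>p. 1 / 2 * log 2 (1 + p)) has_real_derivative 1 / (2 * ln 2 * (1 + x)))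
      (at x within {0..b})"
    by (auto intro!: derivative_eq_intros simp: log_def)
qed (auto intro!: divide_strict_left_mono mult_pos_pos)

lemma su_optimal_staircase:
  assumes "staircase p"
  shows "su_optimal N s E p"
  using assms staircase_le[OF assms _ su_tangent]
  by (auto simp: su_optimal_def is_arg_max_def su_objective_def staircase_def not_less)

lemma su_optimal_unique:
  assumes p: "staircase p" and q: "su_optimal N s E q" and n: "n \<in> {1..N}"
  shows "q n = p n"
  using staircase_less[OF p _ su_tangent n] q p
  by (auto simp: su_optimal_def is_arg_max_def su_objective_def staircase_def)

end

subsection \<open>The value function of the broadcast channel\<close>

text \<open>At power level \<open>z\<close> an infinitesimal layer of power is worth \<open>\<mu>1 / (1 + z)\<close> when spent on user 1
  and \<open>\<mu>2 / (\<sigma>\<^sup>2 + z)\<close> when spent on user 2, up to the factor \<open>1 / (2 * ln 2)\<close>; here \<open>v = \<sigma>\<^sup>2\<close>.\<close>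

definition bc_marginal :: "real \<Rightarrow> real \<Rightarrow> real \<Rightarrow> real \<Rightarrow> real" where
  "bc_marginal v \<mu>1 \<mu>2 z = max (\<mu>1 / (2 * ln 2 * (1 + z))) (\<mu>2 / (2 * ln 2 * (v + z)))"

definition bc_value :: "real \<Rightarrow> real \<Rightarrow> real \<Rightarrow> real \<Rightarrow> real" where
  "bc_value v \<mu>1 \<mu>2 p = integral {0..p} (bc_marginal v \<mu>1 \<mu>2)"

lemma continuous_on_bc_marginal:
  assumes "1 < v" "0 \<le> a"
  shows "continuous_on {a..b} (bc_marginal v \<mu>1 \<mu>2)"
proof -
  have "1 + z \<noteq> 0" "v + z \<noteq> 0" if "z \<in> {a..b}" for z using assms that by auto
  then show ?thesis
    unfolding bc_marginal_def by (intro continuous_intros) auto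
qed

text \<open>The slope comes from the fundamental theorem of calculus. It decreases strictly as a
  maximum of two functions, each strictly decreasing if its weight is positive and zero
  otherwise.\<close>

lemma bc_tangent:
  assumes "1 < v" "0 \<le> \<mu>1" "0 \<le> \<mu>2" "(\<mu>1, \<mu>2) \<noteq> (0, 0)"
  shows "strict_tangent (bc_value v \<mu>1 \<mu>2) (bc_marginal v \<mu>1 \<mu>2)"
proof (rule strict_tangentI)
  fix b x :: real assume "0 \<le> x" "x \<le> b"
  then show "(bc_value v \<mu>1 \<mu>2 has_real_derivative bc_marginal v \<mu>1 \<mu>2 x) (at x within {0..b})"
    unfolding bc_value_def[abs_def]
    using assms by (intro integral_has_real_derivative continuous_on_bc_marginal) auto
next
  fix x y :: real assume xy: "0 \<le> x" "x < y"
  have dec: "\<mu> / (2 * ln 2 * (c + y)) < \<mu> / (2 * ln 2 * (c + x))" if "0 < \<mu>" "0 < c" for \<mu> c :: real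
    using xy that by (intro divide_strict_left_mono mult_pos_pos) auto
  have pos: "0 < \<mu> / (2 * ln 2 * (c + x))" if "0 < \<mu>" "0 < c" for \<mu> c :: real
    using xy that by (intro divide_pos_pos mult_pos_pos) auto
  \<comment> \<open>With one weight zero, its constant term 0 is dominated by the other, positive
    term, so strictness survives.\<close>
  consider "\<mu>1 = 0" "0 < \<mu>2" | "0 < \<mu>1" "\<mu>2 = 0" | "0 < \<mu>1" "0 < \<mu>2"
    using assms by fastforce
  then show "bc_marginal v \<mu>1 \<mu>2 y < bc_marginal v \<mu>1 \<mu>2 x"
    unfolding bc_marginal_def
    by cases (use dec[of \<mu>1 1] dec[of \<mu>2 v] pos[of \<mu>1 1] pos[of \<mu>2 v] assms in
      \<open>auto simp: less_max_iff_disj\<close>)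
next
  fix x :: real assume "0 \<le> x"
  then show "0 \<le> bc_marginal v \<mu>1 \<mu>2 x"
    using assms unfolding bc_marginal_def by (intro max.coboundedI1 divide_nonneg_nonneg) auto
qed

lemma has_integral_log:
  fixes a b c \<mu> :: real
  assumes "a \<le> b" "0 < c + a"
  shows "((\<lambda>z. \<mu> / (2 * ln 2 * (c + z))) has_integral \<mu> / 2 * (log 2 (c + b) - log 2 (c + a))) {a..b}"
proof -
  have "((\<lambda>z. \<mu> / (2 * ln 2 * (c + z))) has_integral
      \<mu> / 2 * log 2 (c + b) - \<mu> / 2 * log 2 (c + a)) {a..b}"
    using assms
    by (intro fundamental_theorem_of_calculus)
      (auto intro!: derivative_eq_intros
        simp: has_real_derivative_iff_has_vector_derivative[symmetric] log_def)
  then show ?thesis by (simp add: right_diff_distrib)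
qed

lemma bc_value_split:
  assumes "1 < v" "0 \<le> a" "a \<le> p"
  shows "bc_value v \<mu>1 \<mu>2 p =
    integral {0..a} (bc_marginal v \<mu>1 \<mu>2) + integral {a..p} (bc_marginal v \<mu>1 \<mu>2)"
  unfolding bc_value_def
  using assms by (intro Henstock_Kurzweil_Integration.integral_combine[symmetric]
      integrable_continuous_interval continuous_on_bc_marginal) auto

text \<open>Spending the lowest \<open>a\<close> units of the power \<open>p\<close> on user 1 and the rest on user 2.\<close>
lemma bc_value_ge:
  assumes "1 < v" "0 \<le> a" "a \<le> p"
  shows "\<mu>1 / 2 * log 2 (1 + a) + \<mu>2 / 2 * (log 2 (v + p) - log 2 (v + a)) \<le> bc_value v \<mu>1 \<mu>2 p"
proof -
  have "\<mu>1 / 2 * (log 2 (1 + a) - log 2 (1 + 0)) \<le> integral {0..a} (bc_marginal v \<mu>1 \<mu>2)"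
    using assms
    by (intro has_integral_le[OF has_integral_log integrable_integral]
        integrable_continuous_interval continuous_on_bc_marginal) (auto simp: bc_marginal_def)
  moreover have "\<mu>2 / 2 * (log 2 (v + p) - log 2 (v + a)) \<le> integral {a..p} (bc_marginal v \<mu>1 \<mu>2)"
    using assms
    by (intro has_integral_le[OF has_integral_log integrable_integral]
        integrable_continuous_interval continuous_on_bc_marginal) (auto simp: bc_marginal_def)
  ultimately show ?thesis using bc_value_split[OF assms] by simp
qed

text \<open>User 1 is the better choice exactly where the affine function
  \<open>\<mu>1 * (v + z) - \<mu>2 * (1 + z)\<close> is nonnegative, and this function is decreasing when it is
  negative at \<open>0\<close>: so the levels served to user 1 lie below those served to user 2.\<close>
lemma bc_threshold:
  fixes v \<mu>1 \<mu>2 p :: real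
  assumes "1 < v" "0 \<le> \<mu>1" "0 \<le> p"
  obtains a where "0 \<le> a" "a \<le> p"
    and "\<And>z. 0 < a \<Longrightarrow> 0 \<le> z \<Longrightarrow> z \<le> a \<Longrightarrow> \<mu>2 * (1 + z) \<le> \<mu>1 * (v + z)"
    and "\<And>z. a < p \<Longrightarrow> a \<le> z \<Longrightarrow> \<mu>1 * (v + z) \<le> \<mu>2 * (1 + z)"
proof -
  have v: "\<mu>1 * 1 \<le> \<mu>1 * v" using assms by (intro mult_left_mono) auto
  \<comment> \<open>User 1 is preferred at every level, user 2 is preferred at every level, or the
    preference changes at a positive level.\<close>
  consider "\<mu>2 \<le> \<mu>1" | "\<mu>1 < \<mu>2" "\<mu>1 * v \<le> \<mu>2" | "\<mu>1 < \<mu>2" "\<mu>2 < \<mu>1 * v" by linarith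
  then show ?thesis
  proof cases
    case 1
    have "\<mu>2 * (1 + z) \<le> \<mu>1 * (v + z)" if "0 \<le> z" for z
      using mult_right_mono[OF 1 that] 1 v by (simp add: algebra_simps)
    then show ?thesis using assms by (intro that[of p]) auto
  next
    case 2
    have "\<mu>1 * (v + z) \<le> \<mu>2 * (1 + z)" if "0 \<le> z" for z
      using mult_right_mono[of \<mu>1 \<mu>2 z] that 2 by (simp add: algebra_simps)
    then show ?thesis using assms by (intro that[of 0]) auto
  next
    case 3
    \<comment> \<open>The zero of \<open>\<mu>1 * (v + z) - \<mu>2 * (1 + z)\<close>. It may exceed
      the available power, hence the witness \<open>min z0 p\<close>.\<close>
    define z0 where "z0 = (\<mu>1 * v - \<mu>2) / (\<mu>2 - \<mu>1)"
    have z0: "0 \<le> z0" "(\<mu>2 - \<mu>1) * z0 = \<mu>1 * v - \<mu>2" using 3 by (auto simp: z0_def)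
    have "\<mu>2 * (1 + z) \<le> \<mu>1 * (v + z)" if "z \<le> z0" for z
      using mult_left_mono[OF that, of "\<mu>2 - \<mu>1"] z0 3 by (simp add: algebra_simps)
    moreover have "\<mu>1 * (v + z) \<le> \<mu>2 * (1 + z)" if "z0 \<le> z" for z
      using mult_left_mono[OF that, of "\<mu>2 - \<mu>1"] z0 3 by (simp add: algebra_simps)
    ultimately show ?thesis
      using assms z0 by (intro that[of "min z0 p"]) (auto simp: min_def split: if_splits)
  qed
qed

text \<open>At the threshold \<open>a\<close> the bound of \<open>bc_value_ge\<close> is an
  equality: the maximum in \<open>bc_marginal\<close> is its first term below \<open>a\<close> and
  its second term above.\<close>

lemma bc_value_attained:
  assumes "1 < v" "0 \<le> \<mu>1" "0 \<le> p"
  obtains a where "0 \<le> a" "a \<le> p"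
    and "bc_value v \<mu>1 \<mu>2 p = \<mu>1 / 2 * log 2 (1 + a) + \<mu>2 / 2 * (log 2 (v + p) - log 2 (v + a))"
proof -
  obtain a where a: "0 \<le> a" "a \<le> p"
    "\<And>z. 0 < a \<Longrightarrow> 0 \<le> z \<Longrightarrow> z \<le> a \<Longrightarrow> \<mu>2 * (1 + z) \<le> \<mu>1 * (v + z)"
    "\<And>z. a < p \<Longrightarrow> a \<le> z \<Longrightarrow> \<mu>1 * (v + z) \<le> \<mu>2 * (1 + z)"
    using bc_threshold[OF assms] by metis
  have cross: "\<mu>2 / (2 * ln 2 * (v + z)) \<le> \<mu>1 / (2 * ln 2 * (1 + z)) \<longleftrightarrow>
      \<mu>2 * (1 + z) \<le> \<mu>1 * (v + z)"
    "\<mu>1 / (2 * ln 2 * (1 + z)) \<le> \<mu>2 / (2 * ln 2 * (v + z)) \<longleftrightarrow>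
      \<mu>1 * (v + z) \<le> \<mu>2 * (1 + z)" if "0 \<le> z" for z
    using that assms by (auto simp: divide_simps mult_ac)
  have 1: "integral {0..a} (bc_marginal v \<mu>1 \<mu>2) = \<mu>1 / 2 * log 2 (1 + a)"
  proof (cases "0 < a")
    case True
    have "integral {0..a} (bc_marginal v \<mu>1 \<mu>2) = integral {0..a} (\<lambda>z. \<mu>1 / (2 * ln 2 * (1 + z)))"
      using a(3) True cross by (intro integral_cong) (auto simp: bc_marginal_def max_absorb1)
    also have "\<dots> = \<mu>1 / 2 * (log 2 (1 + a) - log 2 (1 + 0))"
      using a by (intro integral_unique has_integral_log) auto
    finally show ?thesis by simp
  qed (use a in simp)
  have 2: "integral {a..p} (bc_marginal v \<mu>1 \<mu>2) = \<mu>2 / 2 * (log 2 (v + p) - log 2 (v + a))"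
  proof (cases "a < p")
    case True
    have "integral {a..p} (bc_marginal v \<mu>1 \<mu>2) = integral {a..p} (\<lambda>z. \<mu>2 / (2 * ln 2 * (v + z)))"
      using a(1,4) True cross by (intro integral_cong) (auto simp: bc_marginal_def max_absorb2)
    also have "\<dots> = \<mu>2 / 2 * (log 2 (v + p) - log 2 (v + a))"
      using a assms by (intro integral_unique has_integral_log) auto
    finally show ?thesis .
  qed (use a in simp)
  show ?thesis
    using a bc_value_split[OF assms(1) a(1,2)] 1 2 by (intro that[of a]) auto
qed

section \<open>Rate pairs and the value function\<close>

lemma bc_power_nonneg:
  assumes "1 < \<sigma>\<^sup>2" "0 \<le> r1" "0 \<le> r2"
  shows "0 \<le> bc_power \<sigma> r1 r2"
proof -
  have "1 \<le> 2 powr (2 * (r1 + r2))" "(\<sigma>\<^sup>2 - 1) * 1 \<le> (\<sigma>\<^sup>2 - 1) * 2 powr (2 * r2)"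
    using assms by (auto intro!: mult_left_mono ge_one_powr_ge_zero)
  then show ?thesis by (simp add: bc_power_def)
qed

text \<open>Superposition coding: user 1 takes power \<open>2 powr (2 * r1) - 1\<close>, which user
  2 sees as noise on top of \<open>\<sigma>\<^sup>2\<close>.\<close>

lemma bc_power_shift:
  "\<sigma>\<^sup>2 + bc_power \<sigma> r1 r2 = 2 powr (2 * r2) * (\<sigma>\<^sup>2 + (2 powr (2 * r1) - 1))"
  by (simp add: bc_power_def powr_add algebra_simps)

text \<open>With \<open>a\<close> the power of user 1, both rates become half logarithms of the form
  in \<open>bc_value_ge\<close>; the split of the layers at \<open>a\<close> need not be the best
  one.\<close>

lemma bc_rate_le_value:
  assumes "1 < \<sigma>\<^sup>2" "0 \<le> r1" "0 \<le> r2"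
  shows "\<mu>1 * r1 + \<mu>2 * r2 \<le> bc_value (\<sigma>\<^sup>2) \<mu>1 \<mu>2 (bc_power \<sigma> r1 r2)"
proof -
  define a where "a = 2 powr (2 * r1) - 1"
  have a: "0 \<le> a" using assms by (simp add: a_def ge_one_powr_ge_zero)
  have shift: "\<sigma>\<^sup>2 + bc_power \<sigma> r1 r2 = 2 powr (2 * r2) * (\<sigma>\<^sup>2 + a)"
    unfolding a_def by (rule bc_power_shift)
  have pos: "0 < \<sigma>\<^sup>2 + a" using a assms by linarith
  have "1 * (\<sigma>\<^sup>2 + a) \<le> 2 powr (2 * r2) * (\<sigma>\<^sup>2 + a)"
    using assms a by (intro mult_right_mono ge_one_powr_ge_zero) auto
  then have "a \<le> bc_power \<sigma> r1 r2" using shift by simp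
  moreover have "log 2 (1 + a) = 2 * r1" by (simp add: a_def)
  moreover have "log 2 (\<sigma>\<^sup>2 + bc_power \<sigma> r1 r2) - log 2 (\<sigma>\<^sup>2 + a) = 2 * r2"
    unfolding shift using pos by (simp add: log_mult)
  ultimately show ?thesis
    using bc_value_ge[OF assms(1) a, of "bc_power \<sigma> r1 r2" \<mu>1 \<mu>2] by simp
qed

lemma bc_rates_exist:
  assumes "1 < \<sigma>\<^sup>2" "0 \<le> \<mu>1" "0 \<le> p"
  obtains r1 r2 where "0 \<le> r1" "0 \<le> r2" "bc_power \<sigma> r1 r2 = p"
    and "\<mu>1 * r1 + \<mu>2 * r2 = bc_value (\<sigma>\<^sup>2) \<mu>1 \<mu>2 p"
proof -
  obtain a where a: "0 \<le> a" "a \<le> p"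
    and eq: "bc_value (\<sigma>\<^sup>2) \<mu>1 \<mu>2 p =
      \<mu>1 / 2 * log 2 (1 + a) + \<mu>2 / 2 * (log 2 (\<sigma>\<^sup>2 + p) - log 2 (\<sigma>\<^sup>2 + a))"
    using bc_value_attained[OF assms] by blast
  \<comment> \<open>The rates obtained by giving user 1 the optimal share \<open>a\<close> and user
    2 the rest; \<open>a \<le> p\<close> makes \<open>r2\<close> nonnegative.\<close>
  define r1 r2 where "r1 = log 2 (1 + a) / 2" and "r2 = (log 2 (\<sigma>\<^sup>2 + p) - log 2 (\<sigma>\<^sup>2 + a)) / 2"
  have pos: "0 < \<sigma>\<^sup>2 + a" "0 < \<sigma>\<^sup>2 + p" using a assms by linarith+
  have "2 powr (2 * r1) = 1 + a" using a by (simp add: r1_def)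
  moreover have "2 powr (2 * r2) = (\<sigma>\<^sup>2 + p) / (\<sigma>\<^sup>2 + a)"
    using pos by (simp add: r2_def powr_diff del: right_diff_distrib_numeral)
  ultimately have "\<sigma>\<^sup>2 + bc_power \<sigma> r1 r2 = \<sigma>\<^sup>2 + p"
    using pos by (simp add: bc_power_shift)
  moreover have "0 \<le> r1" "0 \<le> r2" using a pos by (auto simp: r1_def r2_def)
  ultimately show ?thesis using eq by (intro that[of r1 r2]) (auto simp: r1_def r2_def)
qed

section \<open>Reduction of the broadcast problem to total powers\<close>

context energy_harvesting
begin

lemma bc_objective_eq:
  "bc_objective \<mu>1 \<mu>2 N s (r1, r2) = (\<Sum>n=1..N. (\<mu>1 * r1 n + \<mu>2 * r2 n) * slot_length s n)"
  by (simp add: bc_objective_def sum_distrib_left sum.distrib distrib_right mult.assoc)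

lemma bc_feasible_su:
  assumes "1 < \<sigma>\<^sup>2" "bc_feasible \<sigma> N s E (r1, r2)"
  shows "su_feasible N s E (\<lambda>n. bc_power \<sigma> (r1 n) (r2 n))"
  using assms by (auto simp: bc_feasible_def su_feasible_def bc_power_nonneg)

lemma bc_objective_le:
  assumes "1 < \<sigma>\<^sup>2" "bc_feasible \<sigma> N s E (r1, r2)"
  shows "bc_objective \<mu>1 \<mu>2 N s (r1, r2)
    \<le> (\<Sum>n=1..N. bc_value (\<sigma>\<^sup>2) \<mu>1 \<mu>2 (bc_power \<sigma> (r1 n) (r2 n)) * slot_length s n)"
  unfolding bc_objective_eq
proof (intro sum_mono mult_right_mono bc_rate_le_value)
  fix n assume "n \<in> {1..N}"
  then show "0 \<le> slot_length s n" "0 \<le> r1 n" "0 \<le> r2 n"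
    using assms slot_length_pos[of n] by (auto simp: bc_feasible_def)
qed (rule assms(1))

lemma bc_allocation_exists:
  assumes "1 < \<sigma>\<^sup>2" "0 \<le> \<mu>1" "su_feasible N s E p"
  obtains r1 r2 where "bc_feasible \<sigma> N s E (r1, r2)"
    and "bc_objective \<mu>1 \<mu>2 N s (r1, r2) = (\<Sum>n=1..N. bc_value (\<sigma>\<^sup>2) \<mu>1 \<mu>2 (p n) * slot_length s n)"
proof -
  \<comment> \<open>The implication sits under the existentials so that rates can be chosen for
    every natural \<open>n\<close>, arbitrarily outside the slots.\<close>
  have "\<exists>r1 r2. n \<in> {1..N} \<longrightarrow> 0 \<le> r1 \<and> 0 \<le> r2 \<and> bc_power \<sigma> r1 r2 = p n \<and>
      \<mu>1 * r1 + \<mu>2 * r2 = bc_value (\<sigma>\<^sup>2) \<mu>1 \<mu>2 (p n)" for n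
    using bc_rates_exist[OF assms(1,2), of "p n" \<mu>2] assms(3) by (metis su_feasible_def)
  then obtain r1 r2 where r: "\<And>n. n \<in> {1..N} \<Longrightarrow> 0 \<le> r1 n \<and> 0 \<le> r2 n \<and>
      bc_power \<sigma> (r1 n) (r2 n) = p n \<and> \<mu>1 * r1 n + \<mu>2 * r2 n = bc_value (\<sigma>\<^sup>2) \<mu>1 \<mu>2 (p n)"
    by metis
  have "consumed (\<lambda>n. bc_power \<sigma> (r1 n) (r2 n)) j = consumed p j" if "j \<in> {1..N}" for j
    unfolding consumed_def using r that by (intro sum.cong) auto
  then have "bc_feasible \<sigma> N s E (r1, r2)"
    using r assms(3) by (auto simp: bc_feasible_def su_feasible_def energy_causal_iff)
  moreover have "bc_objective \<mu>1 \<mu>2 N s (r1, r2) =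
      (\<Sum>n=1..N. bc_value (\<sigma>\<^sup>2) \<mu>1 \<mu>2 (p n) * slot_length s n)"
    unfolding bc_objective_eq using r by (intro sum.cong) auto
  ultimately show ?thesis by (rule that)
qed

lemma bc_optimal_exists:
  assumes p: "staircase p" and \<mu>: "1 < \<sigma>\<^sup>2" "0 \<le> \<mu>1" "0 \<le> \<mu>2" "(\<mu>1, \<mu>2) \<noteq> (0, 0)"
  shows "\<exists>r1 r2. bc_optimal \<sigma> \<mu>1 \<mu>2 N s E r1 r2"
proof -
  have "su_feasible N s E p" using p by (simp add: staircase_def)
  then obtain r1 r2 where r: "bc_feasible \<sigma> N s E (r1, r2)"
    "bc_objective \<mu>1 \<mu>2 N s (r1, r2) = (\<Sum>n=1..N. bc_value (\<sigma>\<^sup>2) \<mu>1 \<mu>2 (p n) * slot_length s n)"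
    using bc_allocation_exists[OF \<mu>(1,2)] by blast
  have "bc_objective \<mu>1 \<mu>2 N s (q1, q2) \<le> bc_objective \<mu>1 \<mu>2 N s (r1, r2)"
    if "bc_feasible \<sigma> N s E (q1, q2)" for q1 q2
    using bc_objective_le[OF \<mu>(1) that, of \<mu>1 \<mu>2]
      staircase_le[OF p bc_feasible_su[OF \<mu>(1) that] bc_tangent[OF \<mu>]] r(2) by linarith
  then show ?thesis
    using r(1) by (intro exI[of _ r1] exI[of _ r2]) (auto simp: bc_optimal_def is_arg_max_def not_less)
qed

text \<open>If the total powers differed from \<open>p\<close> in one slot, the rates that attain
  the value function along \<open>p\<close> would be strictly better.\<close>

lemma bc_optimal_unique:
  assumes p: "staircase p" and \<mu>: "1 < \<sigma>\<^sup>2" "0 \<le> \<mu>1" "0 \<le> \<mu>2" "(\<mu>1, \<mu>2) \<noteq> (0, 0)"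
    and opt: "bc_optimal \<sigma> \<mu>1 \<mu>2 N s E r1 r2" and n: "n \<in> {1..N}"
  shows "bc_power \<sigma> (r1 n) (r2 n) = p n"
proof (rule ccontr)
  assume neq: "bc_power \<sigma> (r1 n) (r2 n) \<noteq> p n"
  have feas: "bc_feasible \<sigma> N s E (r1, r2)" using opt by (simp add: bc_optimal_def is_arg_max_def)
  have "su_feasible N s E p" using p by (simp add: staircase_def)
  then obtain q1 q2 where q: "bc_feasible \<sigma> N s E (q1, q2)"
    "bc_objective \<mu>1 \<mu>2 N s (q1, q2) = (\<Sum>n=1..N. bc_value (\<sigma>\<^sup>2) \<mu>1 \<mu>2 (p n) * slot_length s n)"
    using bc_allocation_exists[OF \<mu>(1,2)] by blast
  have "bc_objective \<mu>1 \<mu>2 N s (r1, r2) < bc_objective \<mu>1 \<mu>2 N s (q1, q2)"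
    using bc_objective_le[OF \<mu>(1) feas, of \<mu>1 \<mu>2]
      staircase_less[OF p bc_feasible_su[OF \<mu>(1) feas] bc_tangent[OF \<mu>] n neq] q(2) by linarith
  then show False using opt q(1) by (auto simp: bc_optimal_def is_arg_max_def)
qed

end

text \<open>The first three conjuncts assert existence, so that the statements about all optima and
  all outcomes of the recursion are not vacuous.\<close>

theorem lemma3:
  fixes \<sigma> T :: real and N :: nat and s E :: "nat \<Rightarrow> real"
  assumes "\<sigma>\<^sup>2 > 1"
    and "N \<ge> 1"
    and "s 0 = 0"
    and "\<And>n. n < N \<Longrightarrow> s n < s (Suc n)"
    and "s N = T"
    and "\<And>n. n < N \<Longrightarrow> 0 \<le> E n"
  shows
    "(\<forall>\<mu>1 \<mu>2. 0 \<le> \<mu>1 \<and> 0 \<le> \<mu>2 \<and> (\<mu>1, \<mu>2) \<noteq> (0, 0) \<longrightarrow> (\<exists>r1 r2. bc_optimal \<sigma> \<mu>1 \<mu>2 N s E r1 r2))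
     \<and> (\<exists>p. su_optimal N s E p)
     \<and> (\<exists>K i. switching_indices N s E K i)
     \<and> (\<forall>\<mu>1 \<mu>2 \<nu>1 \<nu>2 r1 r2 q1 q2.
          0 \<le> \<mu>1 \<and> 0 \<le> \<mu>2 \<and> (\<mu>1, \<mu>2) \<noteq> (0, 0) \<and> bc_optimal \<sigma> \<mu>1 \<mu>2 N s E r1 r2 \<and>
          0 \<le> \<nu>1 \<and> 0 \<le> \<nu>2 \<and> (\<nu>1, \<nu>2) \<noteq> (0, 0) \<and> bc_optimal \<sigma> \<nu>1 \<nu>2 N s E q1 q2 \<longrightarrow>
          (\<forall>n\<in>{1..N}. bc_power \<sigma> (r1 n) (r2 n) = bc_power \<sigma> (q1 n) (q2 n)))
     \<and> (\<forall>\<mu>1 \<mu>2 r1 r2 p.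
          0 \<le> \<mu>1 \<and> 0 \<le> \<mu>2 \<and> (\<mu>1, \<mu>2) \<noteq> (0, 0) \<and> bc_optimal \<sigma> \<mu>1 \<mu>2 N s E r1 r2 \<and>
          su_optimal N s E p \<longrightarrow>
          (\<forall>n\<in>{1..N}. bc_power \<sigma> (r1 n) (r2 n) = p n))
     \<and> (\<forall>\<mu>1 \<mu>2 r1 r2 K i.
          0 \<le> \<mu>1 \<and> 0 \<le> \<mu>2 \<and> (\<mu>1, \<mu>2) \<noteq> (0, 0) \<and> bc_optimal \<sigma> \<mu>1 \<mu>2 N s E r1 r2 \<and>
          switching_indices N s E K i \<longrightarrow>
          (\<forall>n\<in>{1..K}. \<forall>t\<in>{s (i (n - 1))..<s (i n)}.
             power_profile N s (\<lambda>m. bc_power \<sigma> (r1 m) (r2 m)) t = mean_power s E (i (n - 1)) (i n)))"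
proof -
  interpret energy_harvesting N s E
    using assms by unfold_locales auto
  obtain K0 i0 where "switching_indices N s E K0 i0"
    using switching_indices_exist by blast
  then obtain p where p: "staircase p"
    using switching_indices_staircase by blast
  note \<sigma> = assms(1)
  have profile: "power_profile N s (\<lambda>m. bc_power \<sigma> (r1 m) (r2 m)) t = mean_power s E (i (n - 1)) (i n)"
    if \<mu>: "0 \<le> \<mu>1" "0 \<le> \<mu>2" "(\<mu>1, \<mu>2) \<noteq> (0, 0)" and opt: "bc_optimal \<sigma> \<mu>1 \<mu>2 N s E r1 r2"
      and i: "switching_indices N s E K i" and n: "n \<in> {1..K}" and t: "t \<in> {s (i (n - 1))..<s (i n)}"
    for \<mu>1 \<mu>2 r1 r2 K i n t
  proof -
    \<comment> \<open>This staircase is built from the given \<open>i\<close>, whatever its ties;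
      the total power of the optimum agrees with every staircase, hence with this one.\<close>
    obtain p where p: "staircase p"
      "\<And>k m. k < K \<Longrightarrow> i k < m \<Longrightarrow> m \<le> i (Suc k) \<Longrightarrow> p m = mean_power s E (i k) (i (Suc k))"
      using switching_indices_staircase[OF i] by blast
    have le: "i (n - 1) < i n" "i n \<le> N"
      using i n by (auto simp: switching_indices_def is_arg_min_def)
    obtain m where m: "i (n - 1) < m" "m \<le> i n" "t \<in> {s (m - 1)..<s m}"
      using slot_exists[of "i (n - 1)" "i n" t] le t by auto
    then have "m \<in> {1..N}" using le by auto
    then have "power_profile N s (\<lambda>m. bc_power \<sigma> (r1 m) (r2 m)) t = p m"
      using power_profile_eq m(3) bc_optimal_unique[OF p(1) \<sigma> \<mu> opt] by simp
    moreover have "n - 1 < K" "Suc (n - 1) = n" using n by auto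
    ultimately show ?thesis using p(2)[of "n - 1" m] m by simp
  qed
  show ?thesis
  proof (intro conjI allI impI ballI; (elim conjE)?)
    fix \<mu>1 \<mu>2 :: real assume "0 \<le> \<mu>1" "0 \<le> \<mu>2" "(\<mu>1, \<mu>2) \<noteq> (0, 0)"
    then show "\<exists>r1 r2. bc_optimal \<sigma> \<mu>1 \<mu>2 N s E r1 r2" by (rule bc_optimal_exists[OF p \<sigma>])
  next
    show "\<exists>p. su_optimal N s E p" using su_optimal_staircase[OF p] by blast
  next
    show "\<exists>K i. switching_indices N s E K i" by (rule switching_indices_exist)
  next
    fix \<mu>1 \<mu>2 \<nu>1 \<nu>2 r1 r2 q1 q2 n
    assume "n \<in> {1..N}"
      and "0 \<le> \<mu>1" "0 \<le> \<mu>2" "(\<mu>1, \<mu>2) \<noteq> (0, 0)" "bc_optimal \<sigma> \<mu>1 \<mu>2 N s E r1 r2"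
      and "0 \<le> \<nu>1" "0 \<le> \<nu>2" "(\<nu>1, \<nu>2) \<noteq> (0, 0)" "bc_optimal \<sigma> \<nu>1 \<nu>2 N s E q1 q2"
    then show "bc_power \<sigma> (r1 n) (r2 n) = bc_power \<sigma> (q1 n) (q2 n)"
      using bc_optimal_unique[OF p \<sigma>] by metis
  next
    fix \<mu>1 \<mu>2 r1 r2 q n
    assume "n \<in> {1..N}" and "su_optimal N s E q"
      and "0 \<le> \<mu>1" "0 \<le> \<mu>2" "(\<mu>1, \<mu>2) \<noteq> (0, 0)" "bc_optimal \<sigma> \<mu>1 \<mu>2 N s E r1 r2"
    then show "bc_power \<sigma> (r1 n) (r2 n) = q n"
      using bc_optimal_unique[OF p \<sigma>] su_optimal_unique[OF p] by metis
  qed (rule profile)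
qed

end
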